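(* Let $A$ be the vertex–arc incidence matrix of $G_d$, let $\succ$ be any term order, and let $\mathbf{c}=(c_{i,j})_{1\le i<j\le d}\in\mathbb{R}^n$ satisfy $c_{i,j}+c_{j,k}>c_{i,k}$ for all $i<j<k$ and $c_{i,k}+c_{j,l}>c_{i,l}+c_{j,k}$ for all $i<j<k<l$. Then the reduced Gröbner basis of $I_A$ with respect to $\succ_{\mathbf{c}}$ is $\{x_{i,j}x_{j,k}-x_{i,k}: i<j<k\}\cup\{x_{i,k}x_{j,l}-x_{i,l}x_{j,k}: i<j<k<l\}$.
   Context: $G_d$ has vertices $1,\dots,d$ and arcs $(i,j)$, $1\le i<j\le d$, directed from $i$ to $j$; $n=\binom d2$. Its vertex–arc incidence matrix $A$ has in the column of arc $(i,j)$ entry $1$ in row $i$, $-1$ in row $j$, $0$ elsewhere. $I_A=\langle\mathbf{x}^{\mathbf{u}}-\mathbf{x}^{\mathbf{v}}:A\mathbf{u}=A\mathbf{v},\ \mathbf{u},\mathbf{v}\in\mathbb{N}^n\rangle\subseteq k[x_{i,j}]$. The refinement $\succ_{\mathbf{c}}$ of $\mathbf{c}$ by $\succ$ orders monomials by $\mathbf{x}^{\mathbf{u}}\succ_{\mathbf{c}}\mathbf{x}^{\mathbf{v}}$ iff $\mathbf{c}\cdot\mathbf{u}>\mathbf{c}\cdot\mathbf{v}$, or $\mathbf{c}\cdot\mathbf{u}=\mathbf{c}\cdot\mathbf{v}$ and $\mathbf{x}^{\mathbf{u}}\succ\mathbf{x}^{\mathbf{v}}$. Since $I_A$ is homogeneous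 for the positive grading $\deg x_{i,j}=j-i$, $\succ_{\mathbf{c}}$ acts as a term order on $I_A$ for every $\mathbf{c}$, and reduced Gröbner bases with respect to it exist. *)

theory Defs
  imports Complex_Main "HOL-Library.Poly_Mapping"
begin

text \<open>Monomials are exponent vectors of finite support. Types only provide an ambient supply of
  variables; the polynomial ring in the variables \<open>X\<close> is the carrier set \<open>polys X\<close>.\<close>

type_synonym 'v mon = "'v \<Rightarrow>\<^sub>0 nat"
type_synonym ('v, 'k) mpoly = "('v \<Rightarrow>\<^sub>0 nat) \<Rightarrow>\<^sub>0 'k"

definition mons :: "'v set \<Rightarrow> 'v mon set" where
  "mons X = {u. Poly_Mapping.keys u \<subseteq> X}"

definition polys :: "'v set \<Rightarrow> ('v, 'k::field) mpoly set" where
  "polys X = {f. Poly_Mapping.keys f \<subseteq> mons X}"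

definition xpow :: "'v mon \<Rightarrow> ('v, 'k::field) mpoly" where
  "xpow u = Poly_Mapping.single u 1"

definition var :: "'v \<Rightarrow> ('v, 'k::field) mpoly" where
  "var a = xpow (Poly_Mapping.single a 1)"

definition ideal_of :: "'v set \<Rightarrow> ('v, 'k::field) mpoly set \<Rightarrow> bool" where
  "ideal_of X I \<longleftrightarrow> I \<subseteq> polys X \<and> 0 \<in> I \<and> (\<forall>f\<in>I. \<forall>g\<in>I. f + g \<in> I)
     \<and> (\<forall>q\<in>polys X. \<forall>f\<in>I. q * f \<in> I)"

text \<open>Only meaningful for \<open>S \<subseteq> polys X\<close>.\<close>

definition ideal_gen :: "'v set \<Rightarrow> ('v, 'k::field) mpoly set \<Rightarrow> ('v, 'k) mpoly set" where
  "ideal_gen X S = ideal_of X hull S"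


text \<open>Orders on monomials are given by their strict part, \<open>gt u v\<close> meaning that \<open>x\<^sup>u\<close> is larger than
  \<open>x\<^sup>v\<close>; only the values on \<open>mons X\<close> matter. In a term order the monomial 1 (exponent 0) is the
  smallest one.\<close>

definition term_order :: "'v set \<Rightarrow> ('v mon \<Rightarrow> 'v mon \<Rightarrow> bool) \<Rightarrow> bool" where
  "term_order X gt \<longleftrightarrow>
     irreflp_on (mons X) gt \<and> transp_on (mons X) gt \<and> totalp_on (mons X) gt
     \<and> (\<forall>u\<in>mons X. u \<noteq> 0 \<longrightarrow> gt u 0)
     \<and> (\<forall>u\<in>mons X. \<forall>v\<in>mons X. \<forall>w\<in>mons X. gt u v \<longrightarrow> gt (u + w) (v + w))"

definition weight :: "'v set \<Rightarrow> ('v \<Rightarrow> real) \<Rightarrow> 'v mon \<Rightarrow> real" where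
  "weight X c u = (\<Sum>a\<in>X. c a * real (Poly_Mapping.lookup u a))"

definition refine ::
  "'v set \<Rightarrow> ('v \<Rightarrow> real) \<Rightarrow> ('v mon \<Rightarrow> 'v mon \<Rightarrow> bool) \<Rightarrow> 'v mon \<Rightarrow> 'v mon \<Rightarrow> bool" where
  "refine X c gt u v \<longleftrightarrow>
     weight X c u > weight X c v \<or> weight X c u = weight X c v \<and> gt u v"


text \<open>The definitions below are used for orders that are total on \<open>mons X\<close> but, like \<open>refine X c gt\<close>
  with negative entries in \<open>c\<close>, need not be well-founded. A nonzero polynomial still has a unique
  largest monomial.\<close>

definition lead_mon :: "('v mon \<Rightarrow> 'v mon \<Rightarrow> bool) \<Rightarrow> ('v, 'k::field) mpoly \<Rightarrow> 'v mon" where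
  "lead_mon gt f = (THE u. u \<in> Poly_Mapping.keys f \<and> (\<forall>v\<in>Poly_Mapping.keys f. v \<noteq> u \<longrightarrow> gt u v))"

definition initial_ideal ::
  "'v set \<Rightarrow> ('v mon \<Rightarrow> 'v mon \<Rightarrow> bool) \<Rightarrow> ('v, 'k::field) mpoly set \<Rightarrow> ('v, 'k) mpoly set" where
  "initial_ideal X gt I = ideal_gen X {xpow (lead_mon gt f) | f. f \<in> I \<and> f \<noteq> 0}"

definition groebner_basis ::
  "'v set \<Rightarrow> ('v mon \<Rightarrow> 'v mon \<Rightarrow> bool) \<Rightarrow> ('v, 'k::field) mpoly set \<Rightarrow> ('v, 'k) mpoly set \<Rightarrow> bool" where
  "groebner_basis X gt I G \<longleftrightarrow> finite G \<and> G \<subseteq> I \<and> 0 \<notin> G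
     \<and> ideal_gen X {xpow (lead_mon gt g) | g. g \<in> G} = initial_ideal X gt I"

text \<open>No trailing monomial of \<open>g\<close> may lie in the whole initial ideal. For a well-founded order it
  would suffice to look at the leading monomials of the other elements of \<open>G\<close>; in general a trailing
  monomial of \<open>g\<close> can be a multiple of the leading monomial of \<open>g\<close> itself, and without excluding
  this, reduced bases would not be unique.\<close>

definition reduced_groebner_basis ::
  "'v set \<Rightarrow> ('v mon \<Rightarrow> 'v mon \<Rightarrow> bool) \<Rightarrow> ('v, 'k::field) mpoly set \<Rightarrow> ('v, 'k) mpoly set \<Rightarrow> bool" where
  "reduced_groebner_basis X gt I G \<longleftrightarrow> groebner_basis X gt I G
     \<and> (\<forall>g\<in>G. Poly_Mapping.lookup g (lead_mon gt g) = 1)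
     \<and> (\<forall>g\<in>G. \<forall>h\<in>G. g \<noteq> h \<longrightarrow>
          \<not> (xpow (lead_mon gt h) :: ('v, 'k) mpoly) dvd xpow (lead_mon gt g))
     \<and> (\<forall>g\<in>G. \<forall>u\<in>Poly_Mapping.keys g. u \<noteq> lead_mon gt g \<longrightarrow> xpow u \<notin> initial_ideal X gt I)"


definition arcs :: "nat \<Rightarrow> (nat \<times> nat) set" where
  "arcs d = {(i, j). 1 \<le> i \<and> i < j \<and> j \<le> d}"

definition incidence :: "nat \<Rightarrow> nat \<times> nat \<Rightarrow> int" where
  "incidence v a = (if v = fst a then 1 else if v = snd a then -1 else 0)"

text \<open>The toric ideal of the integer matrix \<open>A\<close> with rows indexed by \<open>R\<close> and columns by \<open>X\<close>.\<close>

definition toric_ideal :: "'r set \<Rightarrow> 'v set \<Rightarrow> ('r \<Rightarrow> 'v \<Rightarrow> int) \<Rightarrow> ('v, 'k::field) mpoly set" where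
  "toric_ideal R X A = ideal_gen X {xpow u - xpow v | u v. u \<in> mons X \<and> v \<in> mons X
     \<and> (\<forall>r\<in>R. (\<Sum>a\<in>X. A r a * int (Poly_Mapping.lookup u a))
            = (\<Sum>a\<in>X. A r a * int (Poly_Mapping.lookup v a)))}"

end

theory Submission
  imports Defs
begin

text \<open>By the hypotheses on \<open>c\<close>, the leading monomials of the proposed basis are the paths
  \<open>x\<^sub>i\<^sub>jx\<^sub>j\<^sub>k\<close> and the crossings \<open>x\<^sub>i\<^sub>kx\<^sub>j\<^sub>l\<close>. Call a monomial standard if none of them divides it: its
  support is then noncrossing and every vertex is only a source or only a sink. A standard monomial
  is determined by its image under the incidence matrix, since the first sink and the last source
  before it must be joined by an arc, which can be split off. Conversely, replacing paths and
  crossings turns every monomial into a smaller standard monomial of the same fiber; the replacement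
  terminates because it decreases a strictly concave function of the arc lengths. So standard
  monomials are the minima of their fibers, whereas a leading monomial of the toric ideal always has
  a smaller companion in its fiber.\<close>

section \<open>Polynomials, ideals and leading monomials\<close>

lemma keys_add_nat: "Poly_Mapping.keys (u + v) = Poly_Mapping.keys u \<union> Poly_Mapping.keys v"
  for u v :: "'v mon"
  by (auto simp: in_keys_iff lookup_add)

lemma mons_add_iff [simp]: "u + v \<in> mons X \<longleftrightarrow> u \<in> mons X \<and> v \<in> mons X"
  by (simp add: mons_def keys_add_nat)

lemma zero_in_mons [simp]: "0 \<in> mons X"
  by (simp add: mons_def)

lemma single_in_mons [simp]: "Poly_Mapping.single a (Suc 0) \<in> mons X \<longleftrightarrow> a \<in> X"
  by (simp add: mons_def)

lemma keys_xpow [simp]: "Poly_Mapping.keys (xpow u :: ('v, 'k::field) mpoly) = {u}"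
  by (simp add: xpow_def)

lemma xpow_mult: "xpow u * xpow v = (xpow (u + v) :: ('v, 'k::field) mpoly)"
  by (simp add: xpow_def mult_single)

lemma lookup_xpow: "Poly_Mapping.lookup (xpow u :: ('v, 'k::field) mpoly) v = (if u = v then 1 else 0)"
  by (simp add: xpow_def lookup_single when_def)

lemma keys_binomial:
  "u \<noteq> v \<Longrightarrow> Poly_Mapping.keys (xpow u - xpow v :: ('v, 'k::field) mpoly) = {u, v}"
  by (auto simp: in_keys_iff lookup_minus lookup_xpow split: if_splits)

text \<open>Every monomial of a product is a sum of one exponent from each factor, so a polynomial
  cofactor already yields a monomial one.\<close>

lemma xpow_dvd_iff: "(xpow u :: ('v, 'k::field) mpoly) dvd xpow v \<longleftrightarrow> (\<exists>w. v = u + w)"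
proof
  assume "(xpow u :: ('v, 'k) mpoly) dvd xpow v"
  then obtain q :: "('v, 'k) mpoly" where "xpow v = xpow u * q" by (auto simp: dvd_def)
  then have "v \<in> Poly_Mapping.keys (xpow u * q)" using keys_xpow[of v] by (metis singletonI)
  then show "\<exists>w. v = u + w" using keys_mult[of "xpow u" q] by auto
next
  assume "\<exists>w. v = u + w"
  then show "(xpow u :: ('v, 'k) mpoly) dvd xpow v" by (metis xpow_mult dvd_triv_left)
qed

lemma polys_mult: "f \<in> polys X \<Longrightarrow> g \<in> polys X \<Longrightarrow> f * g \<in> polys X"
  unfolding polys_def using keys_mult[of f g] by (fastforce simp: subset_iff)

lemma polys_add: "f \<in> polys X \<Longrightarrow> g \<in> polys X \<Longrightarrow> f + g \<in> polys X"
  unfolding polys_def using keys_add[of f g] by blast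

lemma polys_diff: "f \<in> polys X \<Longrightarrow> g \<in> polys X \<Longrightarrow> f - g \<in> polys X"
  unfolding polys_def using keys_diff[of f g] by blast

lemma xpow_in_polys [simp]: "(xpow u :: ('v, 'k::field) mpoly) \<in> polys X \<longleftrightarrow> u \<in> mons X"
  by (simp add: polys_def)

section \<open>Ideals of \<open>polys X\<close>\<close>

lemma ideal_of_polys: "ideal_of X (polys X)"
  by (auto simp: ideal_of_def polys_add polys_mult) (simp add: polys_def)

lemma ideal_of_Inter:
  assumes "\<And>I. I \<in> T \<Longrightarrow> ideal_of X I" "T \<noteq> {}"
  shows "ideal_of X (\<Inter>T)"
proof -
  have "\<Inter>T \<subseteq> polys X" using assms unfolding ideal_of_def by blast
  then show ?thesis using assms(1) by (simp add: ideal_of_def)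
qed

text \<open>The hull intersects all ideals containing \<open>S\<close>; by the hypothesis
  \<open>polys X\<close> is one of them, so the intersection is over a nonempty family.\<close>

lemma ideal_of_ideal_gen:
  assumes "S \<subseteq> polys X"
  shows "ideal_of X (ideal_gen X S)"
  unfolding ideal_gen_def hull_def
  by (rule ideal_of_Inter) (use assms ideal_of_polys in auto)

lemma ideal_gen_minimal: "S \<subseteq> I \<Longrightarrow> ideal_of X I \<Longrightarrow> ideal_gen X S \<subseteq> I"
  unfolding ideal_gen_def by (rule hull_minimal)

lemma ideal_gen_superset: "S \<subseteq> ideal_gen X S"
  unfolding ideal_gen_def by (rule hull_subset)

lemma ideal_of_diff:
  assumes "ideal_of X I" "f \<in> I" "g \<in> I"
  shows "f - g \<in> I"
proof -
  \<comment> \<open>\<open>ideal_of\<close> does not mention negation; it comes from multiplying by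
    the constant polynomial -1.\<close>
  have "Poly_Mapping.single 0 (- 1) \<in> polys X" by (simp add: polys_def)
  then have "Poly_Mapping.single 0 (- 1) * g \<in> I" using assms unfolding ideal_of_def by blast
  moreover have "Poly_Mapping.single 0 (- 1) * g = - g"
    by (simp add: single_uminus single_one)
  ultimately have "f + (- g) \<in> I" using assms unfolding ideal_of_def by metis
  then show ?thesis by simp
qed

text \<open>The polynomials all of whose monomials are multiples of elements of \<open>M\<close>
  form an ideal containing the generators.\<close>

lemma ideal_gen_monomials_divisible:
  assumes "M \<subseteq> mons X" "(xpow u :: ('v, 'k::field) mpoly) \<in> ideal_gen X (xpow ` M)"
  shows "\<exists>m\<in>M. \<exists>w. u = m + w"
proof -
  let ?J = "{f \<in> polys X. \<forall>v\<in>Poly_Mapping.keys f. \<exists>m\<in>M. \<exists>w. v = m + w} :: ('v, 'k) mpoly set"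
  have mult: "\<exists>m\<in>M. \<exists>w. v = m + w"
    if f: "\<forall>v\<in>Poly_Mapping.keys f. \<exists>m\<in>M. \<exists>w. v = m + w"
      and v: "v \<in> Poly_Mapping.keys (q * f)"
    for q f :: "('v, 'k) mpoly" and v
  proof -
    obtain a b where "v = a + b" "b \<in> Poly_Mapping.keys f"
      using v keys_mult[of q f] by blast
    moreover obtain m w where "m \<in> M" "b = m + w" using f \<open>b \<in> Poly_Mapping.keys f\<close> by blast
    ultimately show ?thesis by (metis add.left_commute)
  qed
  have "ideal_of X ?J"
    unfolding ideal_of_def
    using mult by (auto simp: polys_add polys_mult dest!: subsetD[OF keys_add])
      (simp add: polys_def)
  moreover have "xpow ` M \<subseteq> ?J" using assms(1) by (auto intro!: bexI exI[of _ 0])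
  ultimately have "xpow u \<in> ?J" using assms(2) ideal_gen_minimal[of "xpow ` M" ?J X] by (meson subsetD)
  then show ?thesis by simp
qed

text \<open>What survives of a term order under refinement by a weight with negative entries: 1 need
  not be smallest, and well-foundedness may fail.\<close>

definition strict_linorder_on :: "'a set \<Rightarrow> ('a \<Rightarrow> 'a \<Rightarrow> bool) \<Rightarrow> bool" where
  "strict_linorder_on M gt \<longleftrightarrow> irreflp_on M gt \<and> transp_on M gt \<and> totalp_on M gt"

lemma strict_linorder_on_asym:
  "strict_linorder_on M gt \<Longrightarrow> u \<in> M \<Longrightarrow> v \<in> M \<Longrightarrow> gt u v \<Longrightarrow> \<not> gt v u"
  unfolding strict_linorder_on_def by (meson irreflp_onD transp_onD)

lemma lead_mon_eqI:
  assumes "strict_linorder_on (mons X) gt" "f \<in> polys X" "u \<in> Poly_Mapping.keys f"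
    "\<And>v. v \<in> Poly_Mapping.keys f \<Longrightarrow> v \<noteq> u \<Longrightarrow> gt u v"
  shows "lead_mon gt f = u"
  unfolding lead_mon_def
proof (rule the_equality)
  fix v assume v: "v \<in> Poly_Mapping.keys f \<and> (\<forall>w\<in>Poly_Mapping.keys f. w \<noteq> v \<longrightarrow> gt v w)"
  then have "u \<in> mons X" "v \<in> mons X" using assms(2,3) by (auto simp: polys_def)
  then show "v = u" using v assms(3,4) strict_linorder_on_asym[OF assms(1)] by metis
qed (use assms in auto)

lemma lead_mon:
  assumes "strict_linorder_on (mons X) gt" "f \<in> polys X" "f \<noteq> 0"
  shows "lead_mon gt f \<in> Poly_Mapping.keys f"
    and "\<And>v. v \<in> Poly_Mapping.keys f \<Longrightarrow> v \<noteq> lead_mon gt f \<Longrightarrow> gt (lead_mon gt f) v"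
proof -
  have sub: "Poly_Mapping.keys f \<subseteq> mons X" using assms by (simp add: polys_def)
  \<comment> \<open>Finiteness of the support replaces well-foundedness. The arguments of
    \<open>gt\<close> are swapped because the maximum is taken for a less-than relation.\<close>
  have "asymp_on (Poly_Mapping.keys f) (\<lambda>u v. gt v u)"
    using sub strict_linorder_on_asym[OF assms(1)] by (auto intro!: asymp_onI)
  moreover have "transp_on (Poly_Mapping.keys f) (\<lambda>u v. gt v u)"
    using sub assms(1) unfolding strict_linorder_on_def
    by (intro transp_onI) (meson subsetD transp_onD)
  ultimately obtain u where u: "u \<in> Poly_Mapping.keys f"
    "\<forall>v\<in>Poly_Mapping.keys f. v \<noteq> u \<longrightarrow> \<not> gt v u"
    using Finite_Set.bex_max_element[of "Poly_Mapping.keys f" "\<lambda>u v. gt v u"] assms(3) by auto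
  then have gt: "gt u v" if "v \<in> Poly_Mapping.keys f" "v \<noteq> u" for v
    using that sub assms(1) unfolding strict_linorder_on_def by (metis subsetD totalp_onD)
  have "lead_mon gt f = u" using lead_mon_eqI[OF assms(1,2) u(1) gt] .
  then show "lead_mon gt f \<in> Poly_Mapping.keys f"
    and "\<And>v. v \<in> Poly_Mapping.keys f \<Longrightarrow> v \<noteq> lead_mon gt f \<Longrightarrow> gt (lead_mon gt f) v"
    using u gt by auto
qed

lemma lead_mon_in_mons:
  assumes "strict_linorder_on (mons X) gt" "f \<in> polys X" "f \<noteq> 0"
  shows "lead_mon gt f \<in> mons X"
  using lead_mon(1)[OF assms] assms(2) by (auto simp: polys_def)

lemma lead_mon_binomial:
  assumes "strict_linorder_on (mons X) gt" "u \<in> mons X" "v \<in> mons X" "gt u v"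
  shows "lead_mon gt (xpow u - xpow v :: ('v, 'k::field) mpoly) = u"
proof (rule lead_mon_eqI[OF assms(1)])
  have "u \<noteq> v" using assms by (metis strict_linorder_on_asym)
  then show "u \<in> Poly_Mapping.keys (xpow u - xpow v :: ('v, 'k) mpoly)"
    "\<And>w. w \<in> Poly_Mapping.keys (xpow u - xpow v :: ('v, 'k) mpoly) \<Longrightarrow> w \<noteq> u \<Longrightarrow> gt u w"
    using assms(4) by (auto simp: keys_binomial)
qed (use assms in \<open>simp add: polys_diff\<close>)

lemma xpow_lead_mon_in_initial_ideal:
  "f \<in> I \<Longrightarrow> f \<noteq> 0 \<Longrightarrow> xpow (lead_mon gt f) \<in> initial_ideal X gt I"
  unfolding initial_ideal_def by (rule subsetD[OF ideal_gen_superset]) blast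

section \<open>Groebner bases\<close>

text \<open>Both ideals in the definition are generated by monomials, so divisibility of each
  generator of the larger one suffices.\<close>

lemma groebner_basisI:
  fixes I G :: "('v, 'k::field) mpoly set"
  assumes lin: "strict_linorder_on (mons X) gt" and I: "I \<subseteq> polys X"
    and G: "finite G" "G \<subseteq> I" "0 \<notin> G"
    and div: "\<And>f. f \<in> I \<Longrightarrow> f \<noteq> 0 \<Longrightarrow> \<exists>g\<in>G. \<exists>w. lead_mon gt f = lead_mon gt g + w"
  shows "groebner_basis X gt I G"
proof -
  let ?LG = "{xpow (lead_mon gt g) | g. g \<in> G} :: ('v, 'k) mpoly set"
  let ?LI = "{xpow (lead_mon gt f) | f. f \<in> I \<and> f \<noteq> 0} :: ('v, 'k) mpoly set"
  have LI: "?LI \<subseteq> polys X" using lead_mon_in_mons[OF lin subsetD[OF I]] by auto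
  have LG: "?LG \<subseteq> ?LI" using G by blast
  have idG: "ideal_of X (ideal_gen X ?LG)" and idI: "ideal_of X (ideal_gen X ?LI)"
    using LI LG by (blast intro: ideal_of_ideal_gen)+
  have "xpow (lead_mon gt f) \<in> ideal_gen X ?LG" if f: "f \<in> I" "f \<noteq> 0" for f :: "('v, 'k) mpoly"
  proof -
    obtain g w where gw: "g \<in> G" "lead_mon gt f = lead_mon gt g + w" using div[OF f] by blast
    have "lead_mon gt f \<in> mons X" using lead_mon_in_mons[OF lin] f I by blast
    then have "xpow w \<in> (polys X :: ('v, 'k) mpoly set)" using gw(2) by simp
    moreover have "xpow (lead_mon gt g) \<in> ideal_gen X ?LG"
      using gw(1) ideal_gen_superset[of ?LG X] by blast
    ultimately have "xpow w * xpow (lead_mon gt g) \<in> ideal_gen X ?LG"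
      using idG unfolding ideal_of_def by blast
    then show ?thesis by (simp add: xpow_mult gw(2) add.commute)
  qed
  then have "ideal_gen X ?LI \<subseteq> ideal_gen X ?LG" using idG by (intro ideal_gen_minimal) auto
  moreover have "ideal_gen X ?LG \<subseteq> ideal_gen X ?LI"
    using LG idI ideal_gen_superset[of ?LI X] by (intro ideal_gen_minimal) blast+
  ultimately show ?thesis using G unfolding groebner_basis_def initial_ideal_def by blast
qed

text \<open>Converse of the criterion above, for every monomial of the initial ideal. It serves both
  uniqueness and the check of trailing monomials.\<close>

lemma groebner_basis_divides:
  fixes I G :: "('v, 'k::field) mpoly set"
  assumes lin: "strict_linorder_on (mons X) gt" and I: "I \<subseteq> polys X"
    and G: "groebner_basis X gt I G" and u: "(xpow u :: ('v, 'k) mpoly) \<in> initial_ideal X gt I"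
  shows "\<exists>g\<in>G. \<exists>w. u = lead_mon gt g + w"
proof -
  have G': "G \<subseteq> polys X" "0 \<notin> G" using G I unfolding groebner_basis_def by auto
  have "{xpow (lead_mon gt g) | g. g \<in> G} = (xpow ` lead_mon gt ` G :: ('v, 'k) mpoly set)" by blast
  then have "(xpow u :: ('v, 'k) mpoly) \<in> ideal_gen X (xpow ` lead_mon gt ` G)"
    using G u unfolding groebner_basis_def by simp
  moreover have "lead_mon gt ` G \<subseteq> mons X" using lead_mon_in_mons[OF lin] G' by blast
  ultimately show ?thesis using ideal_gen_monomials_divisible[of "lead_mon gt ` G" X u] by blast
qed

text \<open>The classical argument survives without well-foundedness: two elements with the same leading
  monomial differ by an element of \<open>I\<close> none of whose monomials lies in the initial ideal.\<close>

lemma reduced_groebner_basis_unique: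
  fixes I G H :: "('v, 'k::field) mpoly set"
  assumes lin: "strict_linorder_on (mons X) gt" and I: "ideal_of X I"
    and G: "reduced_groebner_basis X gt I G" and H: "reduced_groebner_basis X gt I H"
  shows "G = H"
proof -
  have Ip: "I \<subseteq> polys X" using I by (simp add: ideal_of_def)
  have "G \<subseteq> H" if G: "reduced_groebner_basis X gt I G" and H: "reduced_groebner_basis X gt I H"
    for G H :: "('v, 'k) mpoly set"
  proof
    fix g assume g: "g \<in> G"
    have gbG: "groebner_basis X gt I G" and gbH: "groebner_basis X gt I H"
      using G H by (auto simp: reduced_groebner_basis_def)
    have sub: "G \<subseteq> I - {0}" "H \<subseteq> I - {0}"
      using gbG gbH by (auto simp: groebner_basis_def)
    have lead: "xpow (lead_mon gt f) \<in> initial_ideal X gt I" if "f \<in> G \<union> H" for f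
      using that sub by (intro xpow_lead_mon_in_initial_ideal) auto
    obtain h w where h: "h \<in> H" "lead_mon gt g = lead_mon gt h + w"
      using groebner_basis_divides[OF lin Ip gbH] lead g by blast
    obtain g' w' where g': "g' \<in> G" "lead_mon gt h = lead_mon gt g' + w'"
      using groebner_basis_divides[OF lin Ip gbG] lead h by blast
    have "lead_mon gt g = lead_mon gt g' + (w' + w)" using h g' by (simp add: add.assoc)
    \<comment> \<open>Within the reduced basis \<open>G\<close> no leading monomial divides another.
      The cofactor \<open>w' + w\<close> is then 0, hence so is \<open>w\<close>, exponents being
      natural numbers.\<close>
    then have "g' = g"
      using G g g'(1) unfolding reduced_groebner_basis_def xpow_dvd_iff by metis
    then have "lead_mon gt g = lead_mon gt g + (w' + w)" using h g' by (simp add: add.assoc)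
    then have "Poly_Mapping.lookup (w' + w) a = 0" for a
      by (metis add_cancel_left_right lookup_add)
    then have "w = 0" by (intro poly_mapping_eqI) (simp add: lookup_add)
    then have eq: "lead_mon gt g = lead_mon gt h" using h by simp
    have "g = h"
    proof (rule ccontr)
      assume "g \<noteq> h"
      then have ne: "g - h \<noteq> 0" by simp
      have mem: "g - h \<in> I" using sub g h I by (auto intro: ideal_of_diff)
      let ?u = "lead_mon gt (g - h)"
      have u: "?u \<in> Poly_Mapping.keys (g - h)" using lead_mon(1)[OF lin _ ne] mem Ip by blast
      have "xpow ?u \<in> initial_ideal X gt I" by (rule xpow_lead_mon_in_initial_ideal[OF mem ne])
      \<comment> \<open>Both leading coefficients are 1, so the common leading monomial cancels in
        \<open>g - h\<close>.\<close>
      moreover have "?u \<noteq> lead_mon gt g"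
        using u G H g h eq unfolding reduced_groebner_basis_def by (auto simp: in_keys_iff lookup_minus)
      moreover have "?u \<in> Poly_Mapping.keys g \<or> ?u \<in> Poly_Mapping.keys h"
        using u by (auto simp: in_keys_iff lookup_minus)
      ultimately show False
        using G H g h eq unfolding reduced_groebner_basis_def by metis
    qed
    then show "g \<in> H" using h by simp
  qed
  then show ?thesis using G H by blast
qed

lemma strict_linorder_on_refine:
  assumes "term_order X gt"
  shows "strict_linorder_on (mons X) (refine X c gt)"
  unfolding strict_linorder_on_def
proof (intro conjI)
  have gt: "irreflp_on (mons X) gt" "transp_on (mons X) gt" "totalp_on (mons X) gt"
    using assms by (auto simp: term_order_def)
  show "irreflp_on (mons X) (refine X c gt)"
    using gt(1) by (auto simp: irreflp_on_def refine_def)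
  show "transp_on (mons X) (refine X c gt)"
    using gt(2) unfolding transp_on_def refine_def by (smt (verit))
  show "totalp_on (mons X) (refine X c gt)"
    using gt(3) unfolding totalp_on_def refine_def by (smt (verit))
qed

section \<open>Toric ideals\<close>

text \<open>The linear functional on polynomials with value \<open>\<phi> u\<close> on the basis
  element \<open>xpow u\<close>.\<close>

definition eval_lin :: "('v mon \<Rightarrow> 'k) \<Rightarrow> ('v, 'k::field) mpoly \<Rightarrow> 'k" where
  "eval_lin \<phi> f = (\<Sum>u\<in>Poly_Mapping.keys f. Poly_Mapping.lookup f u * \<phi> u)"

lemma eval_lin_superset:
  assumes "finite K" "Poly_Mapping.keys f \<subseteq> K"
  shows "eval_lin \<phi> f = (\<Sum>u\<in>K. Poly_Mapping.lookup f u * \<phi> u)"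
  unfolding eval_lin_def using assms by (intro sum.mono_neutral_left) (auto simp: in_keys_iff)

lemma eval_lin_zero [simp]: "eval_lin \<phi> 0 = 0"
  by (simp add: eval_lin_def)

lemma eval_lin_single: "eval_lin \<phi> (Poly_Mapping.single u a) = a * \<phi> u"
  by (simp add: eval_lin_superset[of "{u}"])

lemma eval_lin_add: "eval_lin \<phi> (f + g) = eval_lin \<phi> f + eval_lin \<phi> g"
proof -
  let ?K = "Poly_Mapping.keys f \<union> Poly_Mapping.keys g"
  have "Poly_Mapping.keys (f + g) \<subseteq> ?K" by (rule keys_add)
  then show ?thesis
    by (simp add: eval_lin_superset[of ?K] lookup_add sum.distrib distrib_right)
qed

lemma eval_lin_binomial: "eval_lin \<phi> (xpow u - xpow v) = \<phi> u - \<phi> v"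
proof -
  have "eval_lin \<phi> (xpow u - xpow v) + eval_lin \<phi> (xpow v) = eval_lin \<phi> (xpow u)"
    by (simp flip: eval_lin_add)
  then show ?thesis by (simp add: xpow_def eval_lin_single algebra_simps)
qed

lemma poly_mapping_single_induct [case_names zero single add]:
  fixes f :: "'a \<Rightarrow>\<^sub>0 'b::monoid_add"
  assumes "P 0" "\<And>u a. P (Poly_Mapping.single u a)" "\<And>f g. P f \<Longrightarrow> P g \<Longrightarrow> P (f + g)"
  shows "P f"
proof (induction f rule: update_induct)
  case (update f u a)
  have "Poly_Mapping.update u a f = Poly_Mapping.single u a + f"
    using update(1)
    by (intro poly_mapping_eqI) (auto simp: lookup_update lookup_add lookup_single when_def in_keys_iff)
  then show ?case using assms update by simp
qed (rule assms)

text \<open>Both sides are bilinear in \<open>q\<close> and \<open>f\<close>, so single terms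
  suffice.\<close>

lemma eval_lin_mult:
  "eval_lin \<phi> (q * f) = eval_lin (\<lambda>w. eval_lin (\<lambda>u. \<phi> (w + u)) f) q"
proof (induction q rule: poly_mapping_single_induct)
  case (single w a)
  show ?case
  proof (induction f rule: poly_mapping_single_induct)
    case (add f g)
    then show ?case by (simp add: algebra_simps eval_lin_add eval_lin_single)
  qed (simp_all add: mult_single eval_lin_single)
qed (simp_all add: distrib_right eval_lin_add)

text \<open>The values lie in a semiring so that one sum covers real weights, integer vertex
  balances and the natural-number degree.\<close>

definition wsum :: "'v set \<Rightarrow> ('v \<Rightarrow> 'a::comm_semiring_1) \<Rightarrow> 'v mon \<Rightarrow> 'a" where
  "wsum X f u = (\<Sum>a\<in>X. f a * of_nat (Poly_Mapping.lookup u a))"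

lemma wsum_add [simp]: "wsum X f (u + v) = wsum X f u + wsum X f v"
  by (simp add: wsum_def lookup_add distrib_left sum.distrib)

lemma wsum_single [simp]:
  assumes "finite X" "a \<in> X"
  shows "wsum X f (Poly_Mapping.single a (Suc 0)) = f a"
proof -
  have "wsum X f (Poly_Mapping.single a (Suc 0)) = (\<Sum>b\<in>X. if a = b then f b else 0)"
    unfolding wsum_def by (intro sum.cong) (auto simp: lookup_single when_def)
  then show ?thesis using assms by simp
qed

lemma weight_eq_wsum: "weight X c u = wsum X c u"
  by (simp add: weight_def wsum_def)

definition same_fiber :: "'r set \<Rightarrow> 'v set \<Rightarrow> ('r \<Rightarrow> 'v \<Rightarrow> int) \<Rightarrow> 'v mon \<Rightarrow> 'v mon \<Rightarrow> bool" where
  "same_fiber R X A u v \<longleftrightarrow> (\<forall>r\<in>R. wsum X (A r) u = wsum X (A r) v)"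

lemma toric_ideal_eq:
  "toric_ideal R X A = ideal_gen X {xpow u - xpow v | u v. u \<in> mons X \<and> v \<in> mons X \<and> same_fiber R X A u v}"
  by (simp add: toric_ideal_def same_fiber_def wsum_def)

lemma ideal_of_toric_ideal: "ideal_of X (toric_ideal R X A)"
  unfolding toric_ideal_eq by (rule ideal_of_ideal_gen) (auto intro!: polys_diff)

lemma binomial_in_toric_ideal:
  assumes "u \<in> mons X" "v \<in> mons X" "same_fiber R X A u v"
  shows "xpow u - xpow v \<in> toric_ideal R X A"
  unfolding toric_ideal_eq by (rule subsetD[OF ideal_gen_superset]) (use assms in blast)

text \<open>The functionals constant on fibers annihilate the toric ideal; shifting such a functional by
  a monomial gives another one, which is why the annihilated polynomials form an ideal.\<close>

lemma eval_lin_toric_ideal: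
  fixes f :: "('v, 'k::field) mpoly"
  assumes "f \<in> toric_ideal R X A" "\<And>u v. same_fiber R X A u v \<Longrightarrow> \<phi> u = \<phi> v"
  shows "eval_lin \<phi> f = 0"
proof -
  let ?\<Phi> = "{\<phi> :: 'v mon \<Rightarrow> 'k. \<forall>u v. same_fiber R X A u v \<longrightarrow> \<phi> u = \<phi> v}"
  let ?J = "{f \<in> polys X. \<forall>\<phi>\<in>?\<Phi>. eval_lin \<phi> f = 0} :: ('v, 'k) mpoly set"
  have mult: "eval_lin \<psi> (q * g) = 0" if g: "g \<in> ?J" and \<psi>: "\<psi> \<in> ?\<Phi>" for \<psi> g q
  proof -
    have "same_fiber R X A (w + u) (w + v)" if "same_fiber R X A u v" for u v w
      using that by (simp add: same_fiber_def)
    then have "(\<lambda>u. \<psi> (w + u)) \<in> ?\<Phi>" for w using \<psi> by simp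
    then have "eval_lin (\<lambda>u. \<psi> (w + u)) g = 0" for w using g by simp
    then show ?thesis by (simp add: eval_lin_mult) (simp add: eval_lin_def)
  qed
  have "ideal_of X ?J"
    unfolding ideal_of_def
  proof (intro conjI ballI)
    show "q * g \<in> ?J" if "q \<in> polys X" "g \<in> ?J" for q g
    proof -
      have "q * g \<in> polys X" using that by (simp add: polys_mult)
      then show ?thesis using mult[OF that(2)] by simp
    qed
  qed (simp_all add: polys_add eval_lin_add, simp_all add: polys_def)
  moreover have "xpow u - xpow v \<in> ?J"
    if "u \<in> mons X" "v \<in> mons X" "same_fiber R X A u v" for u v
    using that by (simp add: eval_lin_binomial polys_diff)
  then have "{xpow u - xpow v | u v. u \<in> mons X \<and> v \<in> mons X \<and> same_fiber R X A u v} \<subseteq> ?J"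
    by blast
  ultimately have "f \<in> ?J"
    using assms(1) ideal_gen_minimal[of _ ?J X] unfolding toric_ideal_eq by (meson subsetD)
  then have "\<forall>\<psi>\<in>?\<Phi>. eval_lin \<psi> f = 0" by simp
  moreover have "\<phi> \<in> ?\<Phi>" using assms(2) by simp
  ultimately show ?thesis by (rule bspec)
qed

text \<open>The indicator of a fiber is constant on fibers, so the coefficients of \<open>f\<close>
  over the fiber of \<open>u\<close> sum to 0; a lone nonzero one cannot.\<close>

lemma toric_ideal_fiber_partner:
  fixes f :: "('v, 'k::field) mpoly"
  assumes f: "f \<in> toric_ideal R X A" and u: "u \<in> Poly_Mapping.keys f"
  shows "\<exists>v\<in>Poly_Mapping.keys f. v \<noteq> u \<and> same_fiber R X A u v"
proof (rule ccontr)
  assume alone: "\<not> ?thesis"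
  let ?\<phi> = "\<lambda>v. if same_fiber R X A u v then 1 else 0 :: 'k"
  have "eval_lin ?\<phi> f = 0"
    by (rule eval_lin_toric_ideal[OF f]) (auto simp: same_fiber_def)
  moreover have "eval_lin ?\<phi> f = (\<Sum>v\<in>Poly_Mapping.keys f. if v = u then Poly_Mapping.lookup f u else 0)"
    unfolding eval_lin_def using alone by (intro sum.cong) (auto simp: same_fiber_def)
  moreover have "\<dots> = Poly_Mapping.lookup f u" using u by simp
  ultimately show False using u by (simp add: in_keys_iff)
qed

text \<open>Here \<open>standard\<close> is an arbitrary predicate that singles out the minimum of
  each fiber. A standard leading monomial would be the normal form of its fiber partner, hence not
  above it.\<close>

lemma toric_ideal_lead_mon_not_standard:
  fixes f :: "('v, 'k::field) mpoly"
  assumes lin: "strict_linorder_on (mons X) gt"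
    and normal_form: "\<And>u. u \<in> mons X \<Longrightarrow>
      \<exists>v\<in>mons X. standard v \<and> same_fiber R X A u v \<and> (u = v \<or> gt u v)"
    and unique: "\<And>u v. u \<in> mons X \<Longrightarrow> v \<in> mons X \<Longrightarrow> standard u \<Longrightarrow> standard v \<Longrightarrow>
      same_fiber R X A u v \<Longrightarrow> u = v"
    and f: "f \<in> toric_ideal R X A" "f \<noteq> 0"
  shows "\<not> standard (lead_mon gt f)"
proof
  let ?u = "lead_mon gt f"
  assume st: "standard ?u"
  have poly: "f \<in> polys X" using f(1) ideal_of_toric_ideal unfolding ideal_of_def by blast
  note lead = lead_mon[OF lin poly f(2)]
  obtain v where v: "v \<in> Poly_Mapping.keys f" "v \<noteq> ?u" "same_fiber R X A ?u v"
    using toric_ideal_fiber_partner[OF f(1) lead(1)] by blast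
  have mons: "?u \<in> mons X" "v \<in> mons X" using lead(1) v(1) poly by (auto simp: polys_def)
  obtain v' where v': "v' \<in> mons X" "standard v'" "same_fiber R X A v v'" "v = v' \<or> gt v v'"
    using normal_form[OF mons(2)] by blast
  have "same_fiber R X A ?u v'" using v(3) v'(3) by (simp add: same_fiber_def)
  then have "v' = ?u" using unique mons(1) v'(1,2) st by metis
  then show False
    using v v'(4) lead(2)[OF v(1,2)] strict_linorder_on_asym[OF lin mons] by blast
qed

section \<open>Standard monomials of the complete graph\<close>

lemma in_keys_decompose:
  fixes u :: "'v mon"
  assumes "a \<in> Poly_Mapping.keys u"
  obtains w where "u = Poly_Mapping.single a (Suc 0) + w"
proof
  show "u = Poly_Mapping.single a (Suc 0) + (u - Poly_Mapping.single a (Suc 0))"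
    using assms
    by (intro poly_mapping_eqI) (auto simp: lookup_add lookup_minus lookup_single when_def in_keys_iff)
qed

lemma in_keys_decompose2:
  fixes u :: "'v mon"
  assumes "a \<in> Poly_Mapping.keys u" "b \<in> Poly_Mapping.keys u" "a \<noteq> b"
  obtains w where "u = Poly_Mapping.single a (Suc 0) + Poly_Mapping.single b (Suc 0) + w"
proof -
  obtain v where v: "u = Poly_Mapping.single a (Suc 0) + v" using in_keys_decompose assms(1) .
  then have "b \<in> Poly_Mapping.keys v" using assms(2,3) by (auto simp: keys_add_nat)
  then obtain w where "v = Poly_Mapping.single b (Suc 0) + w" by (rule in_keys_decompose)
  then show thesis using that[of w] v by (simp add: add.assoc)
qed

lemma finite_arcs [simp]: "finite (arcs d)"
  by (rule finite_subset[of _ "{..d} \<times> {..d}"]) (auto simp: arcs_def)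

lemma mem_arcs [simp]: "(i, j) \<in> arcs d \<longleftrightarrow> 1 \<le> i \<and> i < j \<and> j \<le> d"
  by (simp add: arcs_def)

abbreviation arc_mon :: "nat \<Rightarrow> nat \<Rightarrow> (nat \<times> nat) mon" where
  "arc_mon i j \<equiv> Poly_Mapping.single (i, j) (Suc 0)"

section \<open>Standard monomials and moves\<close>

definition standard :: "(nat \<times> nat) mon \<Rightarrow> bool" where
  "standard u \<longleftrightarrow>
     (\<forall>i j k. (i, j) \<in> Poly_Mapping.keys u \<longrightarrow> (j, k) \<notin> Poly_Mapping.keys u) \<and>
     (\<forall>i j k l. i < j \<and> j < k \<and> k < l \<and> (i, k) \<in> Poly_Mapping.keys u \<longrightarrow> (j, l) \<notin> Poly_Mapping.keys u)"

text \<open>The proposed binomials as pairs (leading, trailing), so that their combinatorics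
  involves neither the field nor \<open>c\<close>.\<close>

definition moves :: "nat \<Rightarrow> ((nat \<times> nat) mon \<times> (nat \<times> nat) mon) set" where
  "moves d =
     {(arc_mon i j + arc_mon j k, arc_mon i k) | i j k. 1 \<le> i \<and> i < j \<and> j < k \<and> k \<le> d} \<union>
     {(arc_mon i k + arc_mon j l, arc_mon i l + arc_mon j k) | i j k l.
        1 \<le> i \<and> i < j \<and> j < k \<and> k < l \<and> l \<le> d}"

lemma moves_cases [consumes 1, case_names path cross]:
  assumes "(m, n) \<in> moves d"
  obtains i j k where "1 \<le> i" "i < j" "j < k" "k \<le> d" "m = arc_mon i j + arc_mon j k" "n = arc_mon i k"
  | i j k l where "1 \<le> i" "i < j" "j < k" "k < l" "l \<le> d"
      "m = arc_mon i k + arc_mon j l" "n = arc_mon i l + arc_mon j k"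
  using assms unfolding moves_def by blast

lemma moves_path:
  "1 \<le> i \<Longrightarrow> i < j \<Longrightarrow> j < k \<Longrightarrow> k \<le> d \<Longrightarrow>
    (arc_mon i j + arc_mon j k, arc_mon i k) \<in> moves d"
  unfolding moves_def by blast

lemma moves_cross:
  "1 \<le> i \<Longrightarrow> i < j \<Longrightarrow> j < k \<Longrightarrow> k < l \<Longrightarrow> l \<le> d \<Longrightarrow>
    (arc_mon i k + arc_mon j l, arc_mon i l + arc_mon j k) \<in> moves d"
  unfolding moves_def by blast

lemma finite_moves: "finite (moves d)"
proof -
  let ?P = "(\<lambda>(i, j, k). (arc_mon i j + arc_mon j k, arc_mon i k)) ` ({..d} \<times> {..d} \<times> {..d})"
  let ?C = "(\<lambda>(i, j, k, l). (arc_mon i k + arc_mon j l, arc_mon i l + arc_mon j k)) `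
    ({..d} \<times> {..d} \<times> {..d} \<times> {..d})"
  have "(m, n) \<in> ?P \<union> ?C" if "(m, n) \<in> moves d" for m n
    using that
  proof (cases rule: moves_cases)
    case (path i j k)
    then have "(m, n) \<in> ?P" by (intro image_eqI[of _ _ "(i, j, k)"]) auto
    then show ?thesis by (rule UnI1)
  next
    case (cross i j k l)
    then have "(m, n) \<in> ?C" by (intro image_eqI[of _ _ "(i, j, k, l)"]) auto
    then show ?thesis by (rule UnI2)
  qed
  then have "moves d \<subseteq> ?P \<union> ?C" by (rule subrelI)
  then show ?thesis by (rule finite_subset) simp
qed

lemma moves_mons: "(m, n) \<in> moves d \<Longrightarrow> m \<in> mons (arcs d) \<and> n \<in> mons (arcs d)"
  by (cases rule: moves_cases) auto

lemma moves_same_fiber: "(m, n) \<in> moves d \<Longrightarrow> same_fiber R (arcs d) incidence m n"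
  by (cases rule: moves_cases) (auto simp: same_fiber_def incidence_def)

text \<open>A target is a single arc or a nested pair with four distinct endpoints. This is what
  makes the basis reduced in its trailing monomials.\<close>

lemma moves_target_standard: "(m, n) \<in> moves d \<Longrightarrow> standard n"
  by (cases rule: moves_cases) (auto simp: standard_def keys_add_nat)

text \<open>The support of a source consists of two distinct arcs and determines the kind and the
  vertices of the move. Hence no leading monomial divides another.\<close>

lemma moves_source_minimal:
  assumes "(m, n) \<in> moves d" "(m', n') \<in> moves d" "m = m' + w"
  shows "(m, n) = (m', n')"
proof -
  have sub: "Poly_Mapping.keys m' \<subseteq> Poly_Mapping.keys m" using assms(3) by (simp add: keys_add_nat)
  show ?thesis
    using assms(1)
  proof (cases rule: moves_cases)
    case p: (path i j k)
    have km: "Poly_Mapping.keys m = {(i, j), (j, k)}" by (auto simp: p(5) keys_add_nat)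
    show ?thesis
      using assms(2)
    proof (cases rule: moves_cases)
      case q: (path i' j' k')
      have "i' = i \<and> j' = j \<and> k' = k"
        using sub p(1-4) q(1-4) unfolding km q(5) keys_add_nat by auto
      then show ?thesis using p q by simp
    next
      case q: (cross i' j' k' l')
      show ?thesis using sub p(1-4) q(1-5) unfolding km q(6) keys_add_nat by auto
    qed
  next
    case p: (cross i j k l)
    have km: "Poly_Mapping.keys m = {(i, k), (j, l)}" by (auto simp: p(6) keys_add_nat)
    show ?thesis
      using assms(2)
    proof (cases rule: moves_cases)
      case q: (path i' j' k')
      show ?thesis using sub p(1-5) q(1-4) unfolding km q(5) keys_add_nat by auto
    next
      case q: (cross i' j' k' l')
      have "i' = i \<and> j' = j \<and> k' = k \<and> l' = l"
        using sub p(1-5) q(1-5) unfolding km q(6) keys_add_nat by auto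
      then show ?thesis using p q by simp
    qed
  qed
qed

lemma moves_divides_if_not_standard:
  assumes "u \<in> mons (arcs d)" "\<not> standard u"
  shows "\<exists>(m, n)\<in>moves d. \<exists>w. u = m + w"
proof -
  have arc: "1 \<le> i \<and> i < j \<and> j \<le> d" if "(i, j) \<in> Poly_Mapping.keys u" for i j
    using that assms(1) by (auto simp: mons_def)
  consider i j k where "(i, j) \<in> Poly_Mapping.keys u" "(j, k) \<in> Poly_Mapping.keys u"
    | i j k l where "i < j" "j < k" "k < l" "(i, k) \<in> Poly_Mapping.keys u" "(j, l) \<in> Poly_Mapping.keys u"
    using assms(2) unfolding standard_def by blast
  then show ?thesis
  proof cases
    case (1 i j k)
    then have ord: "1 \<le> i" "i < j" "j < k" "k \<le> d" using arc by blast+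
    then obtain w where "u = arc_mon i j + arc_mon j k + w"
      using in_keys_decompose2[OF 1] by blast
    moreover have "(arc_mon i j + arc_mon j k, arc_mon i k) \<in> moves d"
      using ord by (rule moves_path)
    ultimately show ?thesis by blast
  next
    case (2 i j k l)
    then have ord: "1 \<le> i" "l \<le> d" using arc by blast+
    obtain w where "u = arc_mon i k + arc_mon j l + w"
      using in_keys_decompose2[OF 2(4,5)] 2(1) by blast
    moreover have "(arc_mon i k + arc_mon j l, arc_mon i l + arc_mon j k) \<in> moves d"
      using ord(1) 2(1-3) ord(2) by (rule moves_cross)
    ultimately show ?thesis by blast
  qed
qed

lemma not_standard_if_moves_divides:
  assumes "(m, n) \<in> moves d"
  shows "\<not> standard (m + w)"
  using assms
proof (cases rule: moves_cases)
  case (path i j k)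
  then have "(i, j) \<in> Poly_Mapping.keys (m + w)" "(j, k) \<in> Poly_Mapping.keys (m + w)"
    by (auto simp: keys_add_nat)
  then show ?thesis unfolding standard_def by blast
next
  case (cross i j k l)
  then have "(i, k) \<in> Poly_Mapping.keys (m + w)" "(j, l) \<in> Poly_Mapping.keys (m + w)"
    by (auto simp: keys_add_nat)
  then show ?thesis using cross(2-4) unfolding standard_def by blast
qed

text \<open>A strictly concave function of the arc length that vanishes at 0 is strictly subadditive, so
  its sum over the arcs drops along both kinds of moves.\<close>

definition concave_weight :: "nat \<Rightarrow> nat \<times> nat \<Rightarrow> int" where
  "concave_weight d = (\<lambda>(i, j). (int j - int i) * (2 * int d - (int j - int i)))"

text \<open>Arcs have length below \<open>d\<close>, so both factors are positive. This makes the
  sum usable as a natural-number measure.\<close>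

lemma wsum_concave_weight_nonneg: "0 \<le> wsum (arcs d) (concave_weight d) u"
  unfolding wsum_def by (intro sum_nonneg) (auto simp: concave_weight_def arcs_def)

lemma moves_concave_weight:
  assumes "(m, n) \<in> moves d"
  shows "wsum (arcs d) (concave_weight d) n < wsum (arcs d) (concave_weight d) m"
  using assms
proof (cases rule: moves_cases)
  case (path i j k)
  \<comment> \<open>The sum drops by exactly twice this product, and likewise by twice the product
    in the crossing case.\<close>
  have "0 < (int j - int i) * (int k - int j)" using path by simp
  then show ?thesis using path by (simp add: concave_weight_def algebra_simps)
next
  case (cross i j k l)
  have "0 < (int j - int i) * (int l - int k)" using cross by simp
  then show ?thesis using cross by (simp add: concave_weight_def algebra_simps)
qed

text \<open>The induction runs on \<open>concave_weight\<close>, since the weights from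
  \<open>c\<close> are real, possibly negative, and their descent alone does not ensure
  termination.\<close>

lemma moves_normal_form:
  assumes dec: "\<And>m n. (m, n) \<in> moves d \<Longrightarrow> weight (arcs d) c n < weight (arcs d) c m"
    and "u \<in> mons (arcs d)"
  shows "\<exists>v\<in>mons (arcs d). standard v \<and> same_fiber R (arcs d) incidence u v \<and>
    (u = v \<or> weight (arcs d) c v < weight (arcs d) c u)"
  using assms(2)
proof (induction "nat (wsum (arcs d) (concave_weight d) u)" arbitrary: u rule: less_induct)
  case less
  show ?case
  proof (cases "standard u")
    case True
    then show ?thesis using less.prems by (auto simp: same_fiber_def)
  next
    case False
    then obtain m n w where mn: "(m, n) \<in> moves d" and u: "u = m + w"
      using moves_divides_if_not_standard[OF less.prems] by blast
    have mons: "n + w \<in> mons (arcs d)" using less.prems u moves_mons[OF mn] by simp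
    have "wsum (arcs d) (concave_weight d) (n + w) < wsum (arcs d) (concave_weight d) u"
      using moves_concave_weight[OF mn] u by simp
    then have "nat (wsum (arcs d) (concave_weight d) (n + w)) < nat (wsum (arcs d) (concave_weight d) u)"
      using wsum_concave_weight_nonneg[of d "n + w"] by linarith
    then obtain v where v: "v \<in> mons (arcs d)" "standard v" "same_fiber R (arcs d) incidence (n + w) v"
      "n + w = v \<or> weight (arcs d) c v < weight (arcs d) c (n + w)"
      using less.hyps mons by blast
    have "same_fiber R (arcs d) incidence u v"
      using v(3) moves_same_fiber[OF mn, of R] u by (simp add: same_fiber_def)
    moreover have "weight (arcs d) c (n + w) < weight (arcs d) c u"
      using dec[OF mn] u by (simp add: weight_eq_wsum)
    ultimately show ?thesis using v by fastforce
  qed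
qed

section \<open>Uniqueness of the standard monomial in a fiber\<close>

lemma source_if_balance_pos:
  assumes "u \<in> mons (arcs d)" "0 < wsum (arcs d) (incidence i) u"
  shows "\<exists>k. (i, k) \<in> Poly_Mapping.keys u"
proof (rule ccontr)
  assume "\<not> ?thesis"
  then have "wsum (arcs d) (incidence i) u \<le> 0"
    unfolding wsum_def by (intro sum_nonpos) (auto simp: incidence_def in_keys_iff)
  then show False using assms(2) by simp
qed

lemma sink_if_balance_neg:
  assumes "u \<in> mons (arcs d)" "wsum (arcs d) (incidence j) u < 0"
  shows "\<exists>h. (h, j) \<in> Poly_Mapping.keys u"
proof (rule ccontr)
  assume "\<not> ?thesis"
  then have "0 \<le> wsum (arcs d) (incidence j) u"
    unfolding wsum_def by (intro sum_nonneg) (auto simp: incidence_def in_keys_iff)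
  then show False using assms(2) by simp
qed

text \<open>No vertex has both incoming and outgoing arcs, so nothing cancels in its balance.
  Sources and sinks are thus visible in the image under the incidence matrix.\<close>

lemma standard_balance:
  assumes u: "u \<in> mons (arcs d)" "standard u" and ij: "(i, j) \<in> Poly_Mapping.keys u"
  shows "0 < wsum (arcs d) (incidence i) u" "wsum (arcs d) (incidence j) u < 0"
proof -
  have arc: "(i, j) \<in> arcs d" using u(1) ij unfolding mons_def by blast
  have i: "(k, i) \<notin> Poly_Mapping.keys u" and j: "(j, k) \<notin> Poly_Mapping.keys u" for k
    using u(2) ij unfolding standard_def by blast+
  show "0 < wsum (arcs d) (incidence i) u"
    unfolding wsum_def
  proof (rule sum_pos2[of _ "(i, j)"])
    show "0 < incidence i (i, j) * of_nat (Poly_Mapping.lookup u (i, j))"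
      using ij by (simp add: incidence_def in_keys_iff)
    show "0 \<le> incidence i a * of_nat (Poly_Mapping.lookup u a)" for a
      using i by (cases a) (auto simp: incidence_def in_keys_iff)
  qed (use arc in auto)
  have "0 < (\<Sum>a\<in>arcs d. - (incidence j a * of_nat (Poly_Mapping.lookup u a)))"
  proof (rule sum_pos2[of _ "(i, j)"])
    show "0 < - (incidence j (i, j) * of_nat (Poly_Mapping.lookup u (i, j)))"
      using ij arc by (simp add: incidence_def in_keys_iff)
    show "0 \<le> - (incidence j a * of_nat (Poly_Mapping.lookup u a))" for a
      using j by (cases a) (auto simp: incidence_def in_keys_iff)
  qed (use arc in auto)
  then show "wsum (arcs d) (incidence j) u < 0" unfolding wsum_def by (simp add: sum_negf)
qed

lemma standard_subset:
  "standard u \<Longrightarrow> Poly_Mapping.keys v \<subseteq> Poly_Mapping.keys u \<Longrightarrow> standard v"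
  unfolding standard_def by blast

text \<open>The first sink \<open>j\<close> and the last source \<open>i\<close> before it are joined by an arc: otherwise an arc
  leaving \<open>i\<close> would cross an arc entering \<open>j\<close>.\<close>

lemma standard_first_sink_arc:
  assumes u: "u \<in> mons (arcs d)" "standard u"
    and j: "wsum (arcs d) (incidence j) u < 0"
    and j_first: "\<And>k. wsum (arcs d) (incidence k) u < 0 \<Longrightarrow> j \<le> k"
    and i: "0 < wsum (arcs d) (incidence i) u" "i < j"
    and i_last: "\<And>k. 0 < wsum (arcs d) (incidence k) u \<Longrightarrow> k < j \<Longrightarrow> k \<le> i"
  shows "(i, j) \<in> Poly_Mapping.keys u"
proof -
  obtain k where k: "(i, k) \<in> Poly_Mapping.keys u" using source_if_balance_pos[OF u(1) i(1)] by blast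
  obtain h where h: "(h, j) \<in> Poly_Mapping.keys u" using sink_if_balance_neg[OF u(1) j] by blast
  have "h < j" using h u(1) by (auto simp: mons_def)
  then have "h \<le> i" using i_last standard_balance(1)[OF u h] by blast
  moreover have "j \<le> k" using j_first standard_balance(2)[OF u k] by blast
  moreover have "\<not> (h < i \<and> j < k)" using u(2) h k i(2) unfolding standard_def by blast
  ultimately show ?thesis using h k by (metis le_neq_implies_less)
qed

text \<open>A vertex outside \<open>{1..d}\<close> meets no arc; later searches for sinks and
  sources may therefore range over all naturals.\<close>

lemma same_fiber_all_vertices:
  assumes "same_fiber {1..d} (arcs d) incidence u v"
  shows "wsum (arcs d) (incidence r) u = wsum (arcs d) (incidence r) v"
proof (cases "r \<in> {1..d}")
  case False
  then have "wsum (arcs d) (incidence r) w = 0" for w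
    unfolding wsum_def by (intro sum.neutral) (auto simp: incidence_def arcs_def)
  then show ?thesis by simp
qed (use assms in \<open>simp add: same_fiber_def\<close>)

text \<open>The first sink and the last source before it depend only on the balances, which
  \<open>u\<close> and \<open>v\<close> share.\<close>

lemma standard_common_arc:
  assumes u: "u \<in> mons (arcs d)" "standard u" and v: "v \<in> mons (arcs d)" "standard v"
    and fib: "same_fiber {1..d} (arcs d) incidence u v" and "u \<noteq> 0"
  shows "\<exists>a. a \<in> Poly_Mapping.keys u \<and> a \<in> Poly_Mapping.keys v"
proof -
  let ?b = "\<lambda>r. wsum (arcs d) (incidence r) u"
  have b: "wsum (arcs d) (incidence r) v = ?b r" for r using same_fiber_all_vertices[OF fib] by simp
  obtain p q where "(p, q) \<in> Poly_Mapping.keys u"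
    using \<open>u \<noteq> 0\<close> by (metis keys_eq_empty ex_in_conv surj_pair)
  then have "?b q < 0" using standard_balance[OF u] by blast
  define j where "j = (LEAST r. ?b r < 0)"
  have j: "?b j < 0" unfolding j_def by (rule LeastI) fact
  have j_first: "j \<le> k" if "?b k < 0" for k unfolding j_def using that by (rule Least_le)
  \<comment> \<open>The tail of an arc entering \<open>j\<close> is a source before
    \<open>j\<close>, so the maximum below is over a nonempty set.\<close>
  obtain h where h: "(h, j) \<in> Poly_Mapping.keys u" using sink_if_balance_neg[OF u(1) j] by blast
  define i where "i = Max {r. r < j \<and> 0 < ?b r}"
  have fin: "finite {r. r < j \<and> 0 < ?b r}" by simp
  have "h \<in> {r. r < j \<and> 0 < ?b r}"
    using h u(1) standard_balance(1)[OF u h] by (auto simp: mons_def)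
  then have i: "i \<in> {r. r < j \<and> 0 < ?b r}" unfolding i_def using fin by (intro Max_in) auto
  have i_last: "k \<le> i" if "0 < ?b k" "k < j" for k unfolding i_def using fin that by (intro Max_ge) auto
  have "(i, j) \<in> Poly_Mapping.keys u"
    using i by (intro standard_first_sink_arc[OF u j] j_first i_last) auto
  moreover have "(i, j) \<in> Poly_Mapping.keys v"
    using i j j_first i_last by (intro standard_first_sink_arc[OF v]) (auto simp: b)
  ultimately show ?thesis by blast
qed

text \<open>Induction on the degree, which is \<open>wsum\<close> with constant weight 1: a common
  arc is split off from both monomials.\<close>

lemma standard_unique:
  assumes "u \<in> mons (arcs d)" "v \<in> mons (arcs d)" "standard u" "standard v"
    "same_fiber {1..d} (arcs d) incidence u v"
  shows "u = v"
  using assms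
proof (induction "wsum (arcs d) (\<lambda>_. 1 :: nat) u" arbitrary: u v rule: less_induct)
  case less
  note u = less.prems(1,3) and v = less.prems(2,4) and fib = less.prems(5)
  \<comment> \<open>Only one of \<open>u\<close> and \<open>v\<close> will be known to be nonzero,
    so a common arc is sought from either side.\<close>
  have fib': "same_fiber {1..d} (arcs d) incidence v u" using fib by (simp add: same_fiber_def)
  show ?case
  proof (cases "u = 0 \<and> v = 0")
    case False
    then obtain a where a: "a \<in> Poly_Mapping.keys u" "a \<in> Poly_Mapping.keys v"
      using standard_common_arc[OF u v fib] standard_common_arc[OF v u fib'] by blast
    obtain u' where u': "u = Poly_Mapping.single a (Suc 0) + u'" using in_keys_decompose a(1) .
    obtain v' where v': "v = Poly_Mapping.single a (Suc 0) + v'" using in_keys_decompose a(2) .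
    have arc: "a \<in> arcs d" using a(1) u(1) by (auto simp: mons_def)
    have "u' = v'"
    proof (rule less.hyps)
      show "wsum (arcs d) (\<lambda>_. 1) u' < wsum (arcs d) (\<lambda>_. 1 :: nat) u"
        using u' arc by simp
      show "u' \<in> mons (arcs d)" "v' \<in> mons (arcs d)" using u(1) v(1) u' v' by auto
      show "standard u'" using u(2) by (rule standard_subset) (auto simp: u' keys_add_nat)
      show "standard v'" using v(2) by (rule standard_subset) (auto simp: v' keys_add_nat)
      show "same_fiber {1..d} (arcs d) incidence u' v'"
        using fib by (simp add: u' v' same_fiber_def)
    qed
    then show ?thesis using u' v' by simp
  qed simp
qed

section \<open>From moves to the reduced Groebner basis\<close>

definition move_poly :: "(nat \<times> nat) mon \<times> (nat \<times> nat) mon \<Rightarrow> (nat \<times> nat, 'k::field) mpoly" where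
  "move_poly = (\<lambda>(m, n). xpow m - xpow n)"

lemma move_poly_path:
  "move_poly (arc_mon i j + arc_mon j k, arc_mon i k) = var (i, j) * var (j, k) - var (i, k)"
  by (simp add: move_poly_def var_def xpow_mult)

lemma move_poly_cross:
  "move_poly (arc_mon i k + arc_mon j l, arc_mon i l + arc_mon j k) =
    var (i, k) * var (j, l) - var (i, l) * var (j, k)"
  by (simp add: move_poly_def var_def xpow_mult)

lemma move_poly_image:
  "move_poly ` moves d =
     ({var (i, j) * var (j, k) - var (i, k) | i j k. 1 \<le> i \<and> i < j \<and> j < k \<and> k \<le> d}
      \<union> {var (i, k) * var (j, l) - var (i, l) * var (j, k) | i j k l.
           1 \<le> i \<and> i < j \<and> j < k \<and> k < l \<and> l \<le> d} :: (nat \<times> nat, 'k::field) mpoly set)"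
  (is "_ = ?P \<union> ?C")
proof (intro equalityI subsetI)
  fix f :: "(nat \<times> nat, 'k) mpoly"
  assume "f \<in> move_poly ` moves d"
  then obtain m n where f: "f = move_poly (m, n)" and mn: "(m, n) \<in> moves d" by auto
  show "f \<in> ?P \<union> ?C"
    using mn
  proof (cases rule: moves_cases)
    case (path i j k)
    then have "f \<in> ?P" using move_poly_path[of i j k] f by blast
    then show ?thesis by (rule UnI1)
  next
    case (cross i j k l)
    then have "f \<in> ?C" using move_poly_cross[of i k j l] f by blast
    then show ?thesis by (rule UnI2)
  qed
next
  fix f :: "(nat \<times> nat, 'k) mpoly"
  assume "f \<in> ?P \<union> ?C"
  then show "f \<in> move_poly ` moves d"
  proof
    assume "f \<in> ?P"
    then obtain i j k where "1 \<le> i" "i < j" "j < k" "k \<le> d"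
      "f = var (i, j) * var (j, k) - var (i, k)" by blast
    then show ?thesis using moves_path move_poly_path[of i j k] by (metis image_eqI)
  next
    assume "f \<in> ?C"
    then obtain i j k l where "1 \<le> i" "i < j" "j < k" "k < l" "l \<le> d"
      "f = var (i, k) * var (j, l) - var (i, l) * var (j, k)" by blast
    then show ?thesis using moves_cross move_poly_cross[of i k j l] by (metis image_eqI)
  qed
qed

text \<open>The inequalities on \<open>c\<close> enter as one condition: moves lower the weight. The
  weight alone then decides which monomial of each binomial leads.\<close>

lemma reduced_groebner_basis_moves:
  assumes gt: "term_order (arcs d) gt"
    and dec: "\<And>m n. (m, n) \<in> moves d \<Longrightarrow> weight (arcs d) c n < weight (arcs d) c m"
  shows "reduced_groebner_basis (arcs d) (refine (arcs d) c gt)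
    (toric_ideal {1..d} (arcs d) incidence) (move_poly ` moves d :: (nat \<times> nat, 'k::field) mpoly set)"
proof -
  let ?X = "arcs d" and ?gt = "refine (arcs d) c gt"
  let ?I = "toric_ideal {1..d} ?X incidence :: (nat \<times> nat, 'k) mpoly set"
  let ?G = "move_poly ` moves d :: (nat \<times> nat, 'k) mpoly set"
  have lin: "strict_linorder_on (mons ?X) ?gt" using gt by (rule strict_linorder_on_refine)
  have I: "?I \<subseteq> polys ?X" using ideal_of_toric_ideal unfolding ideal_of_def by blast
  have gt_move: "?gt m n" if "(m, n) \<in> moves d" for m n using dec[OF that] by (simp add: refine_def)
  have ne: "m \<noteq> n" if "(m, n) \<in> moves d" for m n using dec[OF that] by auto
  have lead: "lead_mon ?gt (move_poly (m, n) :: (nat \<times> nat, 'k) mpoly) = m" if "(m, n) \<in> moves d" for m n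
    using lead_mon_binomial[OF lin _ _ gt_move[OF that]] moves_mons[OF that] by (simp add: move_poly_def)
  have keys: "Poly_Mapping.keys (move_poly (m, n) :: (nat \<times> nat, 'k) mpoly) = {m, n}"
    if "(m, n) \<in> moves d" for m n
    using ne[OF that] by (simp add: move_poly_def keys_binomial)
  have gb: "groebner_basis ?X ?gt ?I ?G"
  proof (rule groebner_basisI[OF lin I])
    show "finite ?G" using finite_moves by simp
    show "?G \<subseteq> ?I"
      using moves_mons moves_same_fiber by (auto simp: move_poly_def intro!: binomial_in_toric_ideal)
    show "0 \<notin> ?G" using keys by fastforce
    fix f assume f: "f \<in> ?I" "f \<noteq> 0"
    have "\<not> standard (lead_mon ?gt f)"
    proof (rule toric_ideal_lead_mon_not_standard[OF lin _ _ f])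
      fix u assume "u \<in> mons ?X"
      then show "\<exists>v\<in>mons ?X. standard v \<and> same_fiber {1..d} ?X incidence u v \<and> (u = v \<or> ?gt u v)"
        using moves_normal_form[OF dec, of u "{1..d}"] unfolding refine_def by blast
    qed (rule standard_unique)
    then obtain m n w where "(m, n) \<in> moves d" "lead_mon ?gt f = m + w"
      using moves_divides_if_not_standard lead_mon_in_mons[OF lin _ f(2)] f(1) I by blast
    then show "\<exists>g\<in>?G. \<exists>w. lead_mon ?gt f = lead_mon ?gt g + w" using lead by (metis image_eqI)
  qed
  moreover have "Poly_Mapping.lookup g (lead_mon ?gt g) = 1" if g: "g \<in> ?G" for g
  proof -
    obtain m n where "(m, n) \<in> moves d" "g = move_poly (m, n)" using g by auto
    then show ?thesis using lead[of m n] ne[of m n] by (simp add: move_poly_def lookup_minus lookup_xpow)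
  qed
  moreover have "\<not> (xpow (lead_mon ?gt h) :: (nat \<times> nat, 'k) mpoly) dvd xpow (lead_mon ?gt g)"
    if g: "g \<in> ?G" and h: "h \<in> ?G" and "g \<noteq> h" for g h
  proof
    assume "(xpow (lead_mon ?gt h) :: (nat \<times> nat, 'k) mpoly) dvd xpow (lead_mon ?gt g)"
    then obtain w where w: "lead_mon ?gt g = lead_mon ?gt h + w" by (auto simp: xpow_dvd_iff)
    obtain m n where mn: "(m, n) \<in> moves d" "g = move_poly (m, n)" using g by auto
    obtain m' n' where mn': "(m', n') \<in> moves d" "h = move_poly (m', n')" using h by auto
    have "m = m' + w" using w lead[OF mn(1)] lead[OF mn'(1)] mn(2) mn'(2) by simp
    then have "(m, n) = (m', n')" by (rule moves_source_minimal[OF mn(1) mn'(1)])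
    then show False using \<open>g \<noteq> h\<close> mn(2) mn'(2) by simp
  qed
  \<comment> \<open>A trailing monomial is the target of a move, hence standard, whereas monomials
    of the initial ideal are multiples of sources.\<close>
  moreover have "xpow u \<notin> initial_ideal ?X ?gt ?I"
    if g: "g \<in> ?G" and u: "u \<in> Poly_Mapping.keys g" "u \<noteq> lead_mon ?gt g" for g u
  proof
    assume "xpow u \<in> initial_ideal ?X ?gt ?I"
    then obtain h w where h: "h \<in> ?G" "u = lead_mon ?gt h + w"
      using groebner_basis_divides[OF lin I gb] by blast
    obtain m n where mn: "(m, n) \<in> moves d" "g = move_poly (m, n)" using g by auto
    obtain m' n' where mn': "(m', n') \<in> moves d" "h = move_poly (m', n')" using h(1) by auto
    have "u = n" using u keys[OF mn(1)] lead[OF mn(1)] mn(2) by auto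
    moreover have "u = m' + w" using h(2) lead[OF mn'(1)] mn'(2) by simp
    ultimately show False
      using moves_target_standard[OF mn(1)] not_standard_if_moves_divides[OF mn'(1)] by metis
  qed
  ultimately show ?thesis unfolding reduced_groebner_basis_def by blast
qed

theorem theorem4p6:
  fixes d :: nat
    and gt :: "(nat \<times> nat) mon \<Rightarrow> (nat \<times> nat) mon \<Rightarrow> bool"
    and c :: "nat \<times> nat \<Rightarrow> real"
    and G :: "(nat \<times> nat, 'k::field) mpoly set"
  assumes "term_order (arcs d) gt"
    and "\<And>i j k. \<lbrakk>1 \<le> i; i < j; j < k; k \<le> d\<rbrakk> \<Longrightarrow> c (i, j) + c (j, k) > c (i, k)"
    and "\<And>i j k l. \<lbrakk>1 \<le> i; i < j; j < k; k < l; l \<le> d\<rbrakk> \<Longrightarrow>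
           c (i, k) + c (j, l) > c (i, l) + c (j, k)"
  shows "reduced_groebner_basis (arcs d) (refine (arcs d) c gt)
           (toric_ideal {1..d} (arcs d) incidence) G
         \<longleftrightarrow> G = {var (i, j) * var (j, k) - var (i, k) | i j k. 1 \<le> i \<and> i < j \<and> j < k \<and> k \<le> d}
               \<union> {var (i, k) * var (j, l) - var (i, l) * var (j, k) | i j k l.
                    1 \<le> i \<and> i < j \<and> j < k \<and> k < l \<and> l \<le> d}"
proof -
  have "weight (arcs d) c n < weight (arcs d) c m" if "(m, n) \<in> moves d" for m n
    using that
  proof (cases rule: moves_cases)
    case (path i j k)
    then show ?thesis using assms(2)[of i j k] by (simp add: weight_eq_wsum)
  next
    case (cross i j k l)
    then show ?thesis using assms(3)[of i j k l] by (simp add: weight_eq_wsum)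
  qed
  note basis = reduced_groebner_basis_moves[OF assms(1) this]
  \<comment> \<open>Existence gives one direction of the equivalence, uniqueness the other.\<close>
  have "reduced_groebner_basis (arcs d) (refine (arcs d) c gt)
      (toric_ideal {1..d} (arcs d) incidence) G \<longleftrightarrow> G = move_poly ` moves d"
    using basis reduced_groebner_basis_unique[OF strict_linorder_on_refine[OF assms(1)] ideal_of_toric_ideal]
    by metis
  then show ?thesis unfolding move_poly_image .
qed

end
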